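(* Let $j,k$ be integers with $j>|k|$, and let $n\ge 0$ be an integer. If $k\neq 0$ (that is, $j>|k|>0$), then $$F_{j(n+1)}=\frac{F_j}{F_k}\sum_{i=0}^{n}\left(\frac{(-1)^{k+1}F_{j-k}}{F_k}\right)^{n-i}F_{ji+k}.$$ Moreover, for all $j>|k|$ (including $k=0$), $$F_{j(n+1)}=\frac{F_j}{L_k}\sum_{i=0}^{n}\left(\frac{(-1)^{k}L_{j-k}}{L_k}\right)^{n-i}L_{ji+k}.$$
   Context: $F_n$ denotes the Fibonacci numbers: $F_0=0$, $F_1=1$, $F_n=F_{n-1}+F_{n-2}$, and $L_n$ the Lucas numbers: $L_0=2$, $L_1=1$, $L_n=L_{n-1}+L_{n-2}$. Both are extended to all integer indices by their recurrences, so $F_{-n}=(-1)^{n+1}F_n$ and $L_{-n}=(-1)^nL_n$. *)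

theory Defs
  imports Complex_Main "HOL-Number_Theory.Fib"
begin

fun lucas :: "nat \<Rightarrow> nat" where
  "lucas 0 = 2"
| "lucas (Suc 0) = 1"
| "lucas (Suc (Suc n)) = lucas (Suc n) + lucas n"

text \<open>The two-sided sequences use the reflection formulas at negative indices. The lemmas below
  show that these are exactly the two-sided solutions of the recurrence with the given initial values.\<close>

definition fib_int :: "int \<Rightarrow> int" where
  "fib_int m = (if m \<ge> 0 then int (fib (nat m))
                else (-1) ^ (nat (- m) + 1) * int (fib (nat (- m))))"

definition lucas_int :: "int \<Rightarrow> int" where
  "lucas_int m = (if m \<ge> 0 then int (lucas (nat m))
                  else (-1) ^ nat (- m) * int (lucas (nat (- m))))"

lemma fib_int_0: "fib_int 0 = 0" and fib_int_1: "fib_int 1 = 1"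
  by (simp_all add: fib_int_def)

lemma lucas_int_0: "lucas_int 0 = 2" and lucas_int_1: "lucas_int 1 = 1"
  by (simp_all add: lucas_int_def)

lemma int_index_cases:
  fixes m :: int
  obtains (ge2) n where "m = int n + 2" | (one) "m = 1" | (zero) "m = 0" | (neg) n where "m = - int n - 1"
proof -
  consider "m \<ge> 2" | "m = 1" | "m = 0" | "m \<le> -1" by linarith
  then show ?thesis
  proof cases
    case 1
    then have "m = int (nat (m - 2)) + 2" by simp
    then show ?thesis by (rule ge2)
  next
    case 4
    then have "m = - int (nat (- m - 1)) - 1" by simp
    then show ?thesis by (rule neg)
  qed (use one zero in auto)
qed

lemma fib_int_rec: "fib_int m = fib_int (m - 1) + fib_int (m - 2)"
proof (cases m rule: int_index_cases)
  case (ge2 n)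
  have "nat (int n + 2) = Suc (Suc n)" "nat (1 + int n) = Suc n" by simp_all
  with ge2 show ?thesis by (simp add: fib_int_def)
next
  case (neg n)
  then have "nat (- m) = Suc n" "nat (- (m - 1)) = Suc (Suc n)" "nat (- (m - 2)) = Suc (Suc (Suc n))"
    and "\<not> m \<ge> 0" "\<not> m - 1 \<ge> 0" "\<not> m - 2 \<ge> 0"
    by simp_all
  then show ?thesis unfolding fib_int_def by (simp, simp add: algebra_simps)
qed (simp_all add: fib_int_def numeral_2_eq_2)

lemma lucas_int_rec: "lucas_int m = lucas_int (m - 1) + lucas_int (m - 2)"
proof (cases m rule: int_index_cases)
  case (ge2 n)
  have "nat (int n + 2) = Suc (Suc n)" "nat (1 + int n) = Suc n" by simp_all
  with ge2 show ?thesis by (simp add: lucas_int_def)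
next
  case (neg n)
  then have "nat (- m) = Suc n" "nat (- (m - 1)) = Suc (Suc n)" "nat (- (m - 2)) = Suc (Suc (Suc n))"
    and "\<not> m \<ge> 0" "\<not> m - 1 \<ge> 0" "\<not> m - 2 \<ge> 0"
    by simp_all
  then show ?thesis unfolding lucas_int_def by (simp, simp add: algebra_simps)
qed (simp_all add: lucas_int_def numeral_2_eq_2)

lemma two_sided_rec_unique:
  fixes f g :: "int \<Rightarrow> int"
  assumes f: "\<And>m. f m = f (m - 1) + f (m - 2)" and g: "\<And>m. g m = g (m - 1) + g (m - 2)"
    and "f 0 = g 0" and "f 1 = g 1"
  shows "f = g"
proof
  fix m
  have "f m = g m \<and> f (m + 1) = g (m + 1)"
  proof (induction m rule: int_induct[where k = 0])
    case base
    show ?case using assms(3,4) by simp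
  next
    case (step1 i)
    then show ?case using f[of "i + 2"] g[of "i + 2"] by (simp add: algebra_simps)
  next
    case (step2 i)
    then show ?case using f[of "i + 1"] g[of "i + 1"] by simp
  qed
  then show "f m = g m" by simp
qed

end

theory Submission
  imports Defs
begin

text \<open>
  Both formulas are the solution, by iteration, of an inhomogeneous first-order recurrence for
  \<open>n \<mapsto> F\<^bsub>jn\<^esub>\<close>.  With \<open>G = F\<close> or \<open>G = L\<close>, this recurrence is the case \<open>m = jn\<close> of
  \<open>G\<^sub>k F\<^bsub>m+j\<^esub> = c F\<^sub>m + F\<^sub>j G\<^bsub>m+k\<^esub>\<close>,
  where \<open>c\<close> is \<open>(-1)\<^bsup>k+1\<^esup> F\<^bsub>j-k\<^esub>\<close> or \<open>(-1)\<^sup>k L\<^bsub>j-k\<^esub>\<close>.  Dividing by \<open>G\<^sub>k\<close>, which vanishes only for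
  \<open>G = F\<close> and \<open>k = 0\<close>, gives
  \<open>u\<^bsub>n+1\<^esub> = r u\<^sub>n + b\<^sub>n\<close> with \<open>u\<^sub>0 = F\<^sub>0 = 0\<close>, and unrolling it gives the sum.

  The quadratic identity comes from one observation about two solutions \<open>f\<close>, \<open>g\<close> of the Fibonacci
  recurrence: \<open>f\<^bsub>a+1\<^esub> g\<^bsub>b+1\<^esub> + f\<^sub>a g\<^sub>b\<close> depends on \<open>a + b\<close> only (lemma \<open>shifted_product_sum\<close>).
  Therefore a difference \<open>f\<^sub>a g\<^sub>b - f\<^sub>c g\<^sub>d\<close> with \<open>a + b = c + d\<close> just changes its sign when all four
  indices grow by one, and shifting the indices of \<open>F\<^bsub>m+j\<^esub> G\<^sub>k - F\<^sub>j G\<^bsub>m+k\<^esub>\<close> down by \<open>k\<close> reduces it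
  to \<open>G\<^sub>0 F\<^bsub>m+j-k\<^esub> - F\<^bsub>j-k\<^esub> G\<^sub>m\<close> (lemma \<open>product_difference_shift\<close>).  For \<open>G = F\<close> the first term
  vanishes; for \<open>G = L\<close> the difference is \<open>F\<^sub>m L\<^bsub>j-k\<^esub>\<close> by the addition formula
  \<open>2 F\<^bsub>a+b\<^esub> = F\<^sub>a L\<^sub>b + F\<^sub>b L\<^sub>a\<close>.
\<close>

text \<open>Expanding \<open>f\<^bsub>x+2\<^esub>\<close> on one side and \<open>g\<^bsub>y+1\<^esub>\<close> on the other turns both expressions into
  \<open>f\<^sub>x g\<^sub>y + f\<^bsub>x+1\<^esub> g\<^sub>y + f\<^bsub>x+1\<^esub> g\<^bsub>y-1\<^esub>\<close>, so one unit can be moved from the index of \<open>g\<close> to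
  that of \<open>f\<close>, and hence any integer can.\<close>

lemma shifted_product_sum:
  fixes f g :: "int \<Rightarrow> 'a::comm_ring_1"
  assumes f: "\<And>m. f m = f (m - 1) + f (m - 2)" and g: "\<And>m. g m = g (m - 1) + g (m - 2)"
    and "a + b = c + d"
  shows "f (a + 1) * g (b + 1) + f a * g b = f (c + 1) * g (d + 1) + f c * g d"
proof -
  have move: "f (x + 2) * g y + f (x + 1) * g (y - 1) = f (x + 1) * g (y + 1) + f x * g y" for x y
    using f[of "x + 2"] g[of "y + 1"] by (simp add: algebra_simps)
  have "f (a + i + 1) * g (b - i + 1) + f (a + i) * g (b - i) = f (a + 1) * g (b + 1) + f a * g b"
    for i
  proof (induction i rule: int_induct[where k = 0])
    case (step1 i)
    then show ?case using move[of "a + i" "b - i"] by (simp add: algebra_simps)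
  next
    case (step2 i)
    then show ?case using move[of "a + i - 1" "b - i + 1"] by (simp add: algebra_simps)
  qed simp
  from this[of "c - a"] show ?thesis using assms(3) by (simp add: algebra_simps)
qed

text \<open>Subtracting the two sides of \<open>shifted_product_sum\<close> shows that a shift by one negates the
  difference.  This generalizes the identities of Cassini, d'Ocagne and Vajda to a pair of solutions
  of the recurrence.\<close>

lemma product_difference_shift:
  fixes f g :: "int \<Rightarrow> 'a::field"
  assumes f: "\<And>m. f m = f (m - 1) + f (m - 2)" and g: "\<And>m. g m = g (m - 1) + g (m - 2)"
    and "a + b = c + d"
  shows "f (a + k) * g (b + k) - f (c + k) * g (d + k) = (-1) powi k * (f a * g b - f c * g d)"
proof -
  have flip: "f (a + i + 1) * g (b + i + 1) - f (c + i + 1) * g (d + i + 1)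
      = - (f (a + i) * g (b + i) - f (c + i) * g (d + i))" for i
  proof -
    have "(a + i) + (b + i) = (c + i) + (d + i)"
      using assms(3) by simp
    from shifted_product_sum[of f g, OF f g this] show ?thesis
      by (simp add: algebra_simps eq_neg_iff_add_eq_0)
  qed
  show ?thesis
  proof (induction k rule: int_induct[where k = 0])
    case (step1 i)
    have "(-1 :: 'a) powi (i + 1) = - ((-1) powi i)"
      by (simp add: power_int_add)
    then show ?case using flip[of i] step1.IH by (simp add: add.assoc)
  next
    case (step2 i)
    have "(-1 :: 'a) powi (i - 1) = - ((-1) powi i)"
      by (simp add: power_int_diff)
    then show ?case using flip[of "i - 1"] step2.IH by (simp add: add.assoc add_diff_eq)
  qed simp
qed

lemma lucas_int_eq_fib_int: "lucas_int m = 2 * fib_int (m + 1) - fib_int m"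
proof -
  have "lucas_int = (\<lambda>m. 2 * fib_int (m + 1) - fib_int m)"
  proof (rule two_sided_rec_unique[OF lucas_int_rec])
    fix m
    show "2 * fib_int (m + 1) - fib_int m = 2 * fib_int (m - 1 + 1) - fib_int (m - 1)
        + (2 * fib_int (m - 2 + 1) - fib_int (m - 2))"
      using fib_int_rec[of "m + 1"] fib_int_rec[of m] by (simp add: algebra_simps)
  qed (use fib_int_rec[of 2] in \<open>simp_all add: fib_int_0 fib_int_1 lucas_int_0 lucas_int_1\<close>)
  then show ?thesis by (rule fun_cong)
qed

lemma fib_int_add_lucas: "2 * fib_int (m + p) = fib_int m * lucas_int p + fib_int p * lucas_int m"
proof -
  \<comment> \<open>For fixed \<open>m\<close>, both sides satisfy the recurrence in \<open>p\<close>.\<close>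
  have "(\<lambda>p. 2 * fib_int (m + p)) = (\<lambda>p. fib_int m * lucas_int p + fib_int p * lucas_int m)"
  proof (rule two_sided_rec_unique)
    fix p
    show "2 * fib_int (m + p) = 2 * fib_int (m + (p - 1)) + 2 * fib_int (m + (p - 2))"
      using fib_int_rec[of "m + p"] by (simp add: algebra_simps)
    show "fib_int m * lucas_int p + fib_int p * lucas_int m =
        fib_int m * lucas_int (p - 1) + fib_int (p - 1) * lucas_int m
        + (fib_int m * lucas_int (p - 2) + fib_int (p - 2) * lucas_int m)"
      unfolding fib_int_rec[of p] lucas_int_rec[of p] by (simp add: algebra_simps)
  qed (simp_all add: fib_int_0 fib_int_1 lucas_int_0 lucas_int_1 lucas_int_eq_fib_int[of m])
  then show ?thesis by (rule fun_cong)
qed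

lemma real_fib_int_rec:
  "real_of_int (fib_int m) = real_of_int (fib_int (m - 1)) + real_of_int (fib_int (m - 2))"
  using fib_int_rec[of m] by simp

lemma real_lucas_int_rec:
  "real_of_int (lucas_int m) = real_of_int (lucas_int (m - 1)) + real_of_int (lucas_int (m - 2))"
  using lucas_int_rec[of m] by simp

text \<open>The indices are shifted by \<open>k\<close> from a difference in which one product contains \<open>F\<^sub>0 = 0\<close>.\<close>

lemma fib_int_step:
  "real_of_int (fib_int k) * real_of_int (fib_int (m + j))
    = (-1) powi (k + 1) * real_of_int (fib_int (j - k)) * real_of_int (fib_int m)
      + real_of_int (fib_int j) * real_of_int (fib_int (m + k))"
  using product_difference_shift[of "\<lambda>i. real_of_int (fib_int i)" "\<lambda>i. real_of_int (fib_int i)"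
      "m + j - k" 0 "j - k" m k, OF real_fib_int_rec real_fib_int_rec]
  by (simp add: fib_int_0 power_int_add algebra_simps)

text \<open>Now the unshifted difference contains \<open>L\<^sub>0 = 2\<close>, which is what makes the addition formula
  \<open>fib_int_add_lucas\<close> applicable.\<close>

lemma lucas_int_step:
  "real_of_int (lucas_int k) * real_of_int (fib_int (m + j))
    = (-1) powi k * real_of_int (lucas_int (j - k)) * real_of_int (fib_int m)
      + real_of_int (fib_int j) * real_of_int (lucas_int (m + k))"
proof -
  have "real_of_int (fib_int (m + j)) * real_of_int (lucas_int k)
        - real_of_int (fib_int j) * real_of_int (lucas_int (m + k))
      = (-1) powi k * real_of_int (2 * fib_int (m + (j - k)) - fib_int (j - k) * lucas_int m)"
    using product_difference_shift[of "\<lambda>i. real_of_int (fib_int i)" "\<lambda>i. real_of_int (lucas_int i)"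
        "m + j - k" 0 "j - k" m k, OF real_fib_int_rec real_lucas_int_rec]
    by (simp add: lucas_int_0 algebra_simps)
  also have "2 * fib_int (m + (j - k)) - fib_int (j - k) * lucas_int m
      = fib_int m * lucas_int (j - k)"
    using fib_int_add_lucas[of m "j - k"] by simp
  finally show ?thesis by (simp add: algebra_simps)
qed

lemma fib_int_nonzero: "k \<noteq> 0 \<Longrightarrow> fib_int k \<noteq> 0"
  by (auto simp: fib_int_def fib_neq_0_nat)

lemma lucas_pos: "lucas n > 0"
  by (induction n rule: lucas.induct) simp_all

lemma lucas_int_nonzero: "lucas_int k \<noteq> 0"
  using lucas_pos by (simp add: lucas_int_def)

lemma affine_recurrence_sum:
  fixes u b :: "nat \<Rightarrow> 'a::comm_semiring_1"
  assumes "u 0 = 0" and step: "\<And>n. u (Suc n) = r * u n + b n"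
  shows "u (Suc n) = (\<Sum>i=0..n. r ^ (n - i) * b i)"
proof (induction n)
  case 0
  show ?case using step[of 0] assms(1) by simp
next
  case (Suc n)
  have "r * (\<Sum>i=0..n. r ^ (n - i) * b i) = (\<Sum>i=0..n. r ^ (Suc n - i) * b i)"
    by (simp add: sum_distrib_left Suc_diff_le mult.assoc)
  then show ?case using step[of "Suc n"] Suc by simp
qed

text \<open>The common form of the two formulas: \<open>G\<close> is the Fibonacci or the Lucas sequence, and \<open>c\<close> is
  the coefficient in the corresponding quadratic identity.\<close>

lemma fib_int_multiple_sum:
  fixes G :: "int \<Rightarrow> real"
  assumes nz: "G k \<noteq> 0"
    and step: "\<And>m. G k * real_of_int (fib_int (m + j))
        = c * real_of_int (fib_int m) + real_of_int (fib_int j) * G (m + k)"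
  shows "real_of_int (fib_int (j * (int n + 1)))
    = real_of_int (fib_int j) / G k * (\<Sum>i=0..n. (c / G k) ^ (n - i) * G (j * int i + k))"
proof -
  define u where "u i = real_of_int (fib_int (j * int i))" for i
  have "u (Suc i) = c / G k * u i + real_of_int (fib_int j) / G k * G (j * int i + k)" for i
    using step[of "j * int i"] nz by (simp add: u_def field_simps)
  moreover have "u 0 = 0"
    by (simp add: u_def fib_int_0)
  ultimately have "u (Suc n) = (\<Sum>i=0..n. (c / G k) ^ (n - i)
      * (real_of_int (fib_int j) / G k * G (j * int i + k)))"
    by (intro affine_recurrence_sum)
  then show ?thesis
    by (simp add: u_def sum_distrib_left algebra_simps)
qed

theorem theorem5:
  fixes j k :: int and n :: nat
  assumes "j > \<bar>k\<bar>"
  shows "(k \<noteq> 0 \<longrightarrow>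
           real_of_int (fib_int (j * (int n + 1))) =
             real_of_int (fib_int j) / real_of_int (fib_int k) *
             (\<Sum>i=0..n. ((-1) powi (k + 1) * real_of_int (fib_int (j - k)) / real_of_int (fib_int k)) ^ (n - i)
                         * real_of_int (fib_int (j * int i + k))))
       \<and> real_of_int (fib_int (j * (int n + 1))) =
             real_of_int (fib_int j) / real_of_int (lucas_int k) *
             (\<Sum>i=0..n. ((-1) powi k * real_of_int (lucas_int (j - k)) / real_of_int (lucas_int k)) ^ (n - i)
                         * real_of_int (lucas_int (j * int i + k)))"
  using fib_int_multiple_sum[of "\<lambda>i. real_of_int (fib_int i)" k j, OF _ fib_int_step]
    fib_int_multiple_sum[of "\<lambda>i. real_of_int (lucas_int i)" k j, OF _ lucas_int_step]
    fib_int_nonzero lucas_int_nonzero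
  by simp

end
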